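(* Let $X$ be a compact metric space with a reference Borel probability measure $\mu$, and let $\Lambda$ be a set of continuous self-mappings of $X$ endowed with a topology finer than the $C^0$ topology. Let $\mathcal{U}$ be the interior in $\Lambda$ of the set of $L^1$ statistically unstable maps $f\in\Lambda$. Then the set of $L^1$ non-statistical maps in $\mathcal{U}$ is a Baire generic subset of $\mathcal{U}$.
   Context: "Finer" means not necessarily strictly finer. $\mathcal{M}_1(X)$ is the space of Borel probability measures on $X$ with the Wasserstein distance $d_w(\nu_1,\nu_2)=\inf_\zeta\int d(x,y)\,d\zeta$ (infimum over couplings). For $f\in\Lambda$, $e_n^f:X\to\mathcal{M}_1(X)$ is $e_n^f(x)=\frac1n\sum_{i=0}^{n-1}\delta_{f^i(x)}$. For Borel maps $e,e':X\to\mathcal{M}_1(X)$, $d_{L^1}(e,e')=\int_X d_w(e(x),e'(x))\,d\mu(x)$. A map $f$ is $L^1$ non-statistical if $\limsup_{m,n\to\infty}d_{L^1}(e_n^f,e_m^f)>0$. The amplitude of $L^1$ statistical divergence is $\Delta^1(f)=\limsup_{h,g\to f,\ m,n\to\infty;\ h,g\in\Lambda}d_{L^1}(e_n^h,e_m^g)$, i.e. the infimum over neighborhoods $V$ of $f$ in $\Lambda$ and $N\in\mathbb{N}$ of the supremum over $h,g\in V$ and $m,n\ge N$. A map $f\in\Lambda$ is $L^1$ statistically unstable (with respect to $\Lambda$) if $\Delta^1(f)>0$. Baire generic means containing a countable intersection of open dense subsets. *)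

theory Defs
  imports "HOL-Probability.Probability"
begin

text \<open>
  Distances are \<^typ>\<open>ennreal\<close>-valued, so that all infima, suprema and upper limits are taken in a
  complete lattice. Between Borel probability measures on a compact metric space they are finite.
\<close>

text \<open>
  A coupling is a measure on the Borel sets of the product space, not on
  \<^term>\<open>borel \<Otimes>\<^sub>M borel\<close>: the two agree for second countable spaces (hence for compact metric
  spaces), but the former needs no additional sort constraint.
\<close>

definition couplings :: "'a::metric_space measure \<Rightarrow> 'a measure \<Rightarrow> ('a \<times> 'a) measure set" where
  "couplings \<nu>\<^sub>1 \<nu>\<^sub>2 =
    {\<zeta>. prob_space \<zeta> \<and> sets \<zeta> = sets borel \<and> distr \<zeta> borel fst = \<nu>\<^sub>1 \<and> distr \<zeta> borel snd = \<nu>\<^sub>2}"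

definition wasserstein_dist :: "'a::metric_space measure \<Rightarrow> 'a measure \<Rightarrow> ennreal" where
  "wasserstein_dist \<nu>\<^sub>1 \<nu>\<^sub>2 =
    (INF \<zeta>\<in>couplings \<nu>\<^sub>1 \<nu>\<^sub>2. \<integral>\<^sup>+ p. ennreal (dist (fst p) (snd p)) \<partial>\<zeta>)"

text \<open>
  For \<open>n = 0\<close> this is the null measure, which has no coupling with a probability measure. The
  notions below only involve limits as the number of iterates tends to infinity, so the value at
  \<open>0\<close> is irrelevant to them.
\<close>

definition empirical_measure :: "nat \<Rightarrow> ('a::metric_space \<Rightarrow> 'a) \<Rightarrow> 'a \<Rightarrow> 'a measure" where
  "empirical_measure n f x =
    measure_of UNIV (sets borel)
      (\<lambda>A. (\<Sum>i<n. emeasure (return borel ((f ^^ i) x)) A) / of_nat n)"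

lemma space_empirical_measure [simp]: "space (empirical_measure n f x) = UNIV"
  unfolding empirical_measure_def by (subst space_measure_of_conv) simp

lemma sets_empirical_measure [simp, measurable_cong]:
  "sets (empirical_measure n f x) = sets borel"
  using sets.sigma_sets_eq[of "borel :: 'a measure"]
  unfolding empirical_measure_def by (subst sets_measure_of_conv) auto

lemma emeasure_empirical_measure:
  assumes "A \<in> sets borel"
  shows "emeasure (empirical_measure n f x) A =
    (\<Sum>i<n. emeasure (return borel ((f ^^ i) x)) A) / of_nat n"
proof (rule emeasure_measure_of[OF empirical_measure_def])
  show "countably_additive (sets (empirical_measure n f x))
    (\<lambda>A. (\<Sum>i<n. emeasure (return borel ((f ^^ i) x)) A) / of_nat n)"
  proof (rule countably_additiveI)
    fix B :: "nat \<Rightarrow> 'a set"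
    assume B: "range B \<subseteq> sets (empirical_measure n f x)" "disjoint_family B"
    have "(\<Sum>j. (\<Sum>i<n. emeasure (return borel ((f ^^ i) x)) (B j)) / of_nat n) =
        (\<Sum>i<n. \<Sum>j. emeasure (return borel ((f ^^ i) x)) (B j)) / of_nat n"
      by (simp add: divide_ennreal_def suminf_sum)
    also have "(\<Sum>i<n. \<Sum>j. emeasure (return borel ((f ^^ i) x)) (B j)) =
        (\<Sum>i<n. emeasure (return borel ((f ^^ i) x)) (\<Union>j. B j))"
      using B by (intro sum.cong refl suminf_emeasure) auto
    finally show "(\<Sum>j. (\<Sum>i<n. emeasure (return borel ((f ^^ i) x)) (B j)) / of_nat n) =
        (\<Sum>i<n. emeasure (return borel ((f ^^ i) x)) (\<Union> (range B))) / of_nat n" .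
  qed
qed (use assms in \<open>auto simp: positive_def\<close>)

lemma prob_space_empirical_measure:
  assumes "n > 0"
  shows "prob_space (empirical_measure n f x)"
proof (rule prob_spaceI)
  have "of_nat n / of_nat n = (1 :: ennreal)"
    using assms by (intro ennreal_divide_self) (auto simp: of_nat_less_top less_top)
  then show "emeasure (empirical_measure n f x) (space (empirical_measure n f x)) = 1"
    by (simp add: emeasure_empirical_measure)
qed

definition L1_dist ::
    "'a::metric_space measure \<Rightarrow> ('a \<Rightarrow> 'a measure) \<Rightarrow> ('a \<Rightarrow> 'a measure) \<Rightarrow> ennreal" where
  "L1_dist \<mu> e e' = (\<integral>\<^sup>+ x. wasserstein_dist (e x) (e' x) \<partial>\<mu>)"

definition L1_non_statistical :: "'a::metric_space measure \<Rightarrow> ('a \<Rightarrow> 'a) \<Rightarrow> bool" where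
  "L1_non_statistical \<mu> f \<longleftrightarrow>
    Limsup (sequentially \<times>\<^sub>F sequentially)
      (\<lambda>(m, n). L1_dist \<mu> (empirical_measure n f) (empirical_measure m f)) > 0"

text \<open>
  Self-maps are elements of the type of bounded continuous functions with its supremum metric. On a
  compact space these are all the continuous self-maps, with the \<open>C\<^sup>0\<close> topology. The set \<open>\<Lambda>\<close>
  of maps and its topology are given together by an abstract topology \<open>T\<close>, \<open>\<Lambda>\<close> being
  \<open>topspace T\<close>.
\<close>

definition L1_divergence ::
    "'a::metric_space measure \<Rightarrow> ('a \<Rightarrow>\<^sub>C 'a) topology \<Rightarrow> ('a \<Rightarrow>\<^sub>C 'a) \<Rightarrow> ennreal" where
  "L1_divergence \<mu> T f =
    (INF V\<in>{V. openin T V \<and> f \<in> V}. INF N::nat.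
      SUP h\<in>V. SUP g\<in>V. SUP m\<in>{N..}. SUP n\<in>{N..}.
        L1_dist \<mu> (empirical_measure n (apply_bcontfun h)) (empirical_measure m (apply_bcontfun g)))"

definition L1_statistically_unstable ::
    "'a::metric_space measure \<Rightarrow> ('a \<Rightarrow>\<^sub>C 'a) topology \<Rightarrow> ('a \<Rightarrow>\<^sub>C 'a) \<Rightarrow> bool" where
  "L1_statistically_unstable \<mu> T f \<longleftrightarrow> f \<in> topspace T \<and> L1_divergence \<mu> T f > 0"

definition baire_generic_in :: "'b topology \<Rightarrow> 'b set \<Rightarrow> bool" where
  "baire_generic_in Y S \<longleftrightarrow> S \<subseteq> topspace Y \<and>
    (\<exists>\<G>. countable \<G> \<and> (\<forall>G\<in>\<G>. openin Y G \<and> Y closure_of G = topspace Y) \<and>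
      topspace Y \<inter> \<Inter>\<G> \<subseteq> S)"

end

theory Submission
  imports Defs
begin

text \<open>
  Write \<open>\<Delta>\<close> for the amplitude of divergence and \<open>L(n, h; m, g)\<close> for the \<open>L\<^sup>1\<close> distance between the
  \<open>n\<close>-th empirical function of \<open>h\<close> and the \<open>m\<close>-th one of \<open>g\<close>. Fix \<open>c > 0\<close> and call \<open>g\<close>
  oscillating beyond \<open>N\<close> if \<open>L(n, g; m, g) > c\<close> for some \<open>n, m > N\<close>. The theorem rests on the
  claim that if \<open>\<Delta>(f) > 3 c\<close>, then every neighbourhood \<open>V\<close> of \<open>f\<close> contains, for every \<open>N\<close>, a map
  oscillating beyond \<open>N\<close> (\<open>ex_oscillating_map\<close>). Otherwise each map in \<open>V\<close> has all its late
  empirical functions within \<open>c\<close> of the one at the single time \<open>N + 1\<close>. At that fixed time the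
  empirical function depends continuously on the map, so after shrinking \<open>V\<close> those of any two maps
  differ by at most \<open>c\<close>; comparing through time \<open>N + 1\<close> gives \<open>L(n, h; m, g) \<le> 3 c\<close> for all
  \<open>h, g \<in> V\<close> and \<open>n, m > N\<close>, contradicting the size of \<open>\<Delta>(f)\<close>.

  Now let \<open>c\<close> run through \<open>c\<^sub>k = 1 / (k + 1)\<close>. The set of maps with \<open>\<Delta> < 4 c\<^sub>k\<close> is open since
  \<open>\<Delta>\<close> is upper semicontinuous (\<open>openin_small_divergence\<close>), and the set of maps oscillating beyond
  \<open>N\<close> at level \<open>c\<^sub>k\<close> is open since \<open>L(n, g; m, g)\<close> is lower semicontinuous in \<open>g\<close>
  (\<open>openin_oscillating_maps\<close>). By the claim their union is dense in \<open>\<U>\<close>. A map in all these unions,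
  over \<open>k\<close> and \<open>N\<close>, has \<open>\<Delta> \<ge> 4 c\<^sub>k\<close> for some \<open>k\<close> because it is unstable, hence oscillates at
  level \<open>c\<^sub>k\<close> beyond every \<open>N\<close>, and so is non-statistical. Putting \<open>\<Delta> < 4 c\<^sub>k\<close> inside the open sets
  makes them dense in all of \<open>\<U>\<close>, although the claim at level \<open>k\<close> applies only to some of
  its maps.

  The analytic input is the triangle inequality for \<open>L\<close>. The Wasserstein triangle inequality
  needs the gluing of couplings, which is elementary here because empirical measures, and hence all
  their couplings, have finite support (\<open>couplings_glue\<close>). To integrate it, the Wasserstein distance
  of two empirical measures must be a measurable function of the base point
  (\<open>borel_measurable_wasserstein_empirical\<close>).
\<close>

section \<open>Finitely supported laws\<close>

text \<open>
  The index set is kept separate from the points charged, so that changing only the map \<open>u\<close> describes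
  the marginals of a law, and points of an orbit may repeat.
\<close>

definition finite_law :: "'i set \<Rightarrow> ('i \<Rightarrow> ennreal) \<Rightarrow> ('i \<Rightarrow> 'b::topological_space) \<Rightarrow> 'b measure" where
  "finite_law I w u = distr (point_measure I w) borel u"

lemma sets_finite_law [simp, measurable_cong]: "sets (finite_law I w u) = sets borel"
  by (simp add: finite_law_def)

lemma space_finite_law [simp]: "space (finite_law I w u) = UNIV"
  by (simp add: finite_law_def)

lemma nn_integral_finite_law:
  assumes "finite I" "f \<in> borel_measurable borel"
  shows "(\<integral>\<^sup>+p. f p \<partial>finite_law I w u) = (\<Sum>i\<in>I. w i * f (u i))"
  using assms unfolding finite_law_def
  by (subst nn_integral_distr) (auto simp: nn_integral_point_measure_finite)

lemma emeasure_finite_law: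
  assumes "finite I" "A \<in> sets borel"
  shows "emeasure (finite_law I w u) A = (\<Sum>i\<in>I. w i * indicator A (u i))"
  using nn_integral_finite_law[of I "indicator A" w u] assms by simp

lemma distr_finite_law:
  assumes "finite I" "g \<in> borel_measurable borel"
  shows "distr (finite_law I w u) borel g = finite_law I w (\<lambda>i. g (u i))"
  using assms unfolding finite_law_def
  by (subst distr_distr) (auto simp: comp_def)

text \<open>
  Turns a measure that is only known to charge a finite set into explicit weights, so that couplings
  can be manipulated as finite matrices.
\<close>

lemma eq_finite_law_if_finite_support:
  fixes M :: "'b::t1_space measure"
  assumes M: "sets M = sets borel" and S: "finite S" "emeasure M (- S) = 0"
  shows "M = finite_law S (\<lambda>p. emeasure M {p}) (\<lambda>p. p)"
proof (rule measure_eqI)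
  fix A assume "A \<in> sets M"
  then have A: "A \<in> sets borel" using M by simp
  have fin: "B \<in> sets borel" if "finite B" for B :: "'b set"
    using that by (intro borel_closed finite_imp_closed)
  have sets': "A \<inter> S \<in> sets M" "A - S \<in> sets M" "- S \<in> sets M"
    using A fin[of S] S M by auto
  have "emeasure M A = emeasure M (A \<inter> S) + emeasure M (A - S)"
    using sets' by (subst plus_emeasure) (auto intro!: arg_cong[where f = "emeasure M"])
  also have "emeasure M (A - S) = 0"
    using emeasure_mono[of "A - S" "- S" M] sets' S by auto
  also have "emeasure M (A \<inter> S) = (\<Sum>p\<in>A \<inter> S. emeasure M {p})"
    using S M fin by (intro emeasure_eq_sum_singleton) auto
  also have "\<dots> = (\<Sum>p\<in>S. emeasure M {p} * indicator A p)"
    using S by (intro sum.mono_neutral_cong_left) (auto simp: indicator_def)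
  finally show "emeasure M A = emeasure (finite_law S (\<lambda>p. emeasure M {p}) (\<lambda>p. p)) A"
    using A S by (simp add: emeasure_finite_law)
qed (use M in simp)

lemma empirical_measure_eq_finite_law:
  "empirical_measure n f x = finite_law {..<n} (\<lambda>_. 1 / of_nat n) (\<lambda>i. (f ^^ i) x)"
proof (rule measure_eqI)
  fix A assume "A \<in> sets (empirical_measure n f x)"
  then have "A \<in> sets borel" by simp
  then show "emeasure (empirical_measure n f x) A =
      emeasure (finite_law {..<n} (\<lambda>_. 1 / of_nat n) (\<lambda>i. (f ^^ i) x)) A"
    by (simp add: emeasure_empirical_measure emeasure_finite_law divide_ennreal_def
        sum_distrib_left mult.commute)
qed simp

lemma empirical_measure_finite_support:
  "emeasure (empirical_measure n f x) (- (\<lambda>i. (f ^^ i) x) ` {..<n}) = 0"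
proof -
  have "- (\<lambda>i. (f ^^ i) x) ` {..<n} \<in> sets borel"
    by (intro borel_open open_Compl finite_imp_closed) simp
  then show ?thesis
    by (auto simp: empirical_measure_eq_finite_law emeasure_finite_law indicator_def)
qed

section \<open>The Wasserstein triangle inequality\<close>

lemma borel_measurable_pair_dist [measurable, simp]:
  "(\<lambda>p::'a::metric_space \<times> 'a. ennreal (dist (fst p) (snd p))) \<in> borel_measurable borel"
  by (intro measurable_compose[OF _ measurable_ennreal] borel_measurable_continuous_onI continuous_intros)

lemma borel_measurable_fst_snd [measurable, simp]:
  "fst \<in> borel_measurable borel" "snd \<in> borel_measurable borel"
  by (intro borel_measurable_continuous_onI continuous_intros)+

lemma finite_coupling:
  assumes "finite I" "(\<Sum>i\<in>I. w i) = 1"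
  shows "finite_law I w (\<lambda>i. (u i, v i)) \<in> couplings (finite_law I w u) (finite_law I w v)"
  using assms by (auto simp: couplings_def distr_finite_law emeasure_finite_law intro!: prob_spaceI)

lemma wasserstein_dist_finite_law_le:
  assumes "finite I" "(\<Sum>i\<in>I. w i) = 1"
  shows "wasserstein_dist (finite_law I w u) (finite_law I w v)
    \<le> (\<Sum>i\<in>I. w i * ennreal (dist (u i) (v i)))"
proof -
  have "wasserstein_dist (finite_law I w u) (finite_law I w v)
      \<le> (\<integral>\<^sup>+ p. ennreal (dist (fst p) (snd p)) \<partial>finite_law I w (\<lambda>i. (u i, v i)))"
    unfolding wasserstein_dist_def by (rule INF_lower[OF finite_coupling[OF assms]])
  then show ?thesis
    using assms by (simp add: nn_integral_finite_law)
qed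

text \<open>
  Outside \<open>S \<times> S\<close> one of the two coordinates lies outside \<open>S\<close>, which is a null event for the
  corresponding marginal.
\<close>

lemma coupling_finite_support:
  assumes \<zeta>: "\<zeta> \<in> couplings a b" and S: "finite S" "emeasure a (- S) = 0" "emeasure b (- S) = 0"
  shows "\<zeta> = finite_law (S \<times> S) (\<lambda>p. emeasure \<zeta> {p}) (\<lambda>p. p)"
proof (rule eq_finite_law_if_finite_support)
  show sets_\<zeta>: "sets \<zeta> = sets borel" using \<zeta> by (simp add: couplings_def)
  then have [measurable_cong]: "sets \<zeta> = sets borel" .
  have sp: "space \<zeta> = UNIV" using sets_eq_imp_space_eq[OF sets_\<zeta>] by simp
  have S_borel: "- S \<in> sets borel"
    using S(1) by (intro borel_open open_Compl finite_imp_closed)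
  have m: "fst \<in> measurable \<zeta> borel" "snd \<in> measurable \<zeta> borel"
    by measurable
  have "a = distr \<zeta> borel fst" "b = distr \<zeta> borel snd"
    using \<zeta> by (simp_all add: couplings_def)
  then have "emeasure \<zeta> (fst -` (- S)) = 0" "emeasure \<zeta> (snd -` (- S)) = 0"
    using S S_borel m sp by (simp_all add: emeasure_distr)
  moreover have "fst -` (- S) \<in> sets \<zeta>" "snd -` (- S) \<in> sets \<zeta>"
    using measurable_sets[OF m(1) S_borel] measurable_sets[OF m(2) S_borel] sp by simp_all
  ultimately have "emeasure \<zeta> (fst -` (- S) \<union> snd -` (- S)) = 0"
    by (metis emeasure_Un_null_set null_setsI)
  moreover have "- (S \<times> S) = fst -` (- S) \<union> snd -` (- S)" by auto
  ultimately show "emeasure \<zeta> (- (S \<times> S)) = 0" by simp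
qed (use S in simp)

text \<open>
  The gluing of two couplings along their common marginal \<open>b\<close>: conditionally on the middle point \<open>y\<close>,
  choose \<open>x\<close> and \<open>z\<close> independently according to \<open>\<zeta>\<^sub>1\<close> and \<open>\<zeta>\<^sub>2\<close>. With finite supports this is the
  weight \<open>\<zeta>\<^sub>1{(x, y)} \<zeta>\<^sub>2{(y, z)} / b{y}\<close> on triples, and the cost estimate is the triangle
  inequality of the metric summed against these weights.
\<close>

lemma couplings_glue:
  assumes \<zeta>: "\<zeta>\<^sub>1 \<in> couplings a b" and \<zeta>': "\<zeta>\<^sub>2 \<in> couplings b c"
    and S: "finite S" "emeasure a (- S) = 0" "emeasure b (- S) = 0" "emeasure c (- S) = 0"
  obtains \<zeta> where "\<zeta> \<in> couplings a c"
    "(\<integral>\<^sup>+ p. ennreal (dist (fst p) (snd p)) \<partial>\<zeta>) \<le>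
     (\<integral>\<^sup>+ p. ennreal (dist (fst p) (snd p)) \<partial>\<zeta>\<^sub>1) + (\<integral>\<^sup>+ p. ennreal (dist (fst p) (snd p)) \<partial>\<zeta>\<^sub>2)"
proof -
  define z1 where "z1 p = emeasure \<zeta>\<^sub>1 {p}" for p
  define z2 where "z2 p = emeasure \<zeta>\<^sub>2 {p}" for p
  define \<beta> where "\<beta> y = emeasure b {y}" for y
  note fin = S(1)
  have \<zeta>1: "\<zeta>\<^sub>1 = finite_law (S \<times> S) z1 (\<lambda>p. p)" and \<zeta>2: "\<zeta>\<^sub>2 = finite_law (S \<times> S) z2 (\<lambda>p. p)"
    unfolding z1_def z2_def using coupling_finite_support \<zeta> \<zeta>' S by blast+
  have a: "a = finite_law (S \<times> S) z1 fst"
    using \<zeta> fin distr_finite_law[of "S \<times> S" fst z1 "\<lambda>p. p"] \<zeta>1 by (simp add: couplings_def)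
  have b1: "b = finite_law (S \<times> S) z1 snd"
    using \<zeta> fin distr_finite_law[of "S \<times> S" snd z1 "\<lambda>p. p"] \<zeta>1 by (simp add: couplings_def)
  have b2: "b = finite_law (S \<times> S) z2 fst"
    using \<zeta>' fin distr_finite_law[of "S \<times> S" fst z2 "\<lambda>p. p"] \<zeta>2 by (simp add: couplings_def)
  have c: "c = finite_law (S \<times> S) z2 snd"
    using \<zeta>' fin distr_finite_law[of "S \<times> S" snd z2 "\<lambda>p. p"] \<zeta>2 by (simp add: couplings_def)
  have b1': "\<beta> y = (\<Sum>x\<in>S. z1 (x, y))" if "y \<in> S" for y
  proof -
    have "\<beta> y = (\<Sum>x\<in>S. \<Sum>y'\<in>S. z1 (x, y') * indicator {y} y')"
      unfolding \<beta>_def by (subst b1) (simp add: fin emeasure_finite_law sum.cartesian_product')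
    also have "\<dots> = (\<Sum>x\<in>S. z1 (x, y))"
      using that fin by (simp add: indicator_def if_distrib sum.delta' cong: if_cong)
    finally show ?thesis .
  qed
  have b2': "\<beta> y = (\<Sum>z\<in>S. z2 (y, z))" if "y \<in> S" for y
  proof -
    have "\<beta> y = (\<Sum>y'\<in>S. \<Sum>z\<in>S. z2 (y', z) * indicator {y} y')"
      unfolding \<beta>_def by (subst b2) (simp add: fin emeasure_finite_law sum.cartesian_product')
    also have "\<dots> = (\<Sum>z\<in>S. \<Sum>y'\<in>S. z2 (y', z) * indicator {y} y')"
      by (rule sum.swap)
    also have "\<dots> = (\<Sum>z\<in>S. z2 (y, z))"
      using that fin by (simp add: indicator_def if_distrib sum.delta' cong: if_cong)
    finally show ?thesis .
  qed
  have "prob_space b"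
  proof -
    have "prob_space \<zeta>\<^sub>1" "b = distr \<zeta>\<^sub>1 borel snd"
      using \<zeta> by (simp_all add: couplings_def)
    moreover have "snd \<in> measurable \<zeta>\<^sub>1 borel"
      by (subst \<zeta>1) (simp add: measurable_cong_sets[OF sets_finite_law refl])
    ultimately show ?thesis by (simp add: prob_space.prob_space_distr)
  qed
  then interpret b: prob_space b .
  have \<beta>_top: "\<beta> y \<noteq> \<top>" for y
    unfolding \<beta>_def by simp
  define w where "w = (\<lambda>(x, y, z). z1 (x, y) * z2 (y, z) / \<beta> y)"
  define I where "I = S \<times> S \<times> S"
  \<comment> \<open>The marginals of \<open>w\<close> on adjacent coordinates are \<open>z1\<close> and \<open>z2\<close>. Where \<open>\<beta> y = 0\<close>, the
    quotient is \<open>0\<close>, and so are all weights \<open>z1 (x, y)\<close> and \<open>z2 (y, z)\<close>.\<close>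
  have w1: "(\<Sum>z\<in>S. w (x, y, z)) = z1 (x, y)" if "x \<in> S" "y \<in> S" for x y
  proof -
    have "(\<Sum>z\<in>S. w (x, y, z)) = z1 (x, y) * \<beta> y / \<beta> y"
      using that by (simp add: w_def b2' divide_ennreal_def sum_distrib_left sum_distrib_right)
    also have "\<dots> = z1 (x, y)"
    proof (cases "\<beta> y = 0")
      case True
      then have "z1 (x, y) = 0" using b1'[OF that(2)] that fin by simp
      then show ?thesis by simp
    qed (simp add: ennreal_mult_divide_eq \<beta>_top)
    finally show ?thesis .
  qed
  have w2: "(\<Sum>x\<in>S. w (x, y, z)) = z2 (y, z)" if "y \<in> S" "z \<in> S" for y z
  proof -
    have "(\<Sum>x\<in>S. w (x, y, z)) = z2 (y, z) * \<beta> y / \<beta> y"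
      using that by (simp add: w_def b1' divide_ennreal_def sum_distrib_left sum_distrib_right mult_ac)
    also have "\<dots> = z2 (y, z)"
    proof (cases "\<beta> y = 0")
      case True
      then have "z2 (y, z) = 0" using b2'[OF that(1)] that fin by simp
      then show ?thesis by simp
    qed (simp add: ennreal_mult_divide_eq \<beta>_top)
    finally show ?thesis .
  qed
  have I: "finite I" using fin by (simp add: I_def)
  have sum1: "(\<Sum>(x, y, z)\<in>I. w (x, y, z) * h x y) = (\<Sum>(x, y)\<in>S \<times> S. z1 (x, y) * h x y)"
    for h
    by (simp add: I_def sum.cartesian_product' sum_distrib_right[symmetric] w1)
  have sum2: "(\<Sum>(x, y, z)\<in>I. w (x, y, z) * h y z) = (\<Sum>(y, z)\<in>S \<times> S. z2 (y, z) * h y z)"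
    for h
  proof -
    have "(\<Sum>(x, y, z)\<in>I. w (x, y, z) * h y z) = (\<Sum>x\<in>S. \<Sum>p\<in>S\<times>S. w (x, p) * h (fst p) (snd p))"
      by (simp add: I_def sum.cartesian_product')
    also have "\<dots> = (\<Sum>p\<in>S\<times>S. \<Sum>x\<in>S. w (x, p) * h (fst p) (snd p))"
      by (rule sum.swap)
    also have "\<dots> = (\<Sum>(y, z)\<in>S \<times> S. z2 (y, z) * h y z)"
      by (simp add: sum.cartesian_product' sum_distrib_right[symmetric] w2)
    finally show ?thesis .
  qed
  define X where "X = (\<lambda>(x::'a, y::'a, z::'a). x)"
  define Z where "Z = (\<lambda>(x::'a, y::'a, z::'a). z)"
  have a': "a = finite_law I w X"
  proof (rule measure_eqI)
    fix A assume "A \<in> sets a"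
    then have "A \<in> sets borel" by (simp add: a)
    then show "emeasure a A = emeasure (finite_law I w X) A"
      using sum1[of "\<lambda>x y. indicator A x"] I fin
      by (simp add: a emeasure_finite_law X_def case_prod_unfold)
  qed (simp add: a)
  have c': "c = finite_law I w Z"
  proof (rule measure_eqI)
    fix A assume "A \<in> sets c"
    then have "A \<in> sets borel" by (simp add: c)
    then show "emeasure c A = emeasure (finite_law I w Z) A"
      using sum2[of "\<lambda>y z. indicator A z"] I fin
      by (simp add: c emeasure_finite_law Z_def case_prod_unfold)
  qed (simp add: c)
  have "emeasure \<zeta>\<^sub>1 UNIV = 1"
    using \<zeta> prob_space.emeasure_space_1[of \<zeta>\<^sub>1] \<zeta>1 unfolding couplings_def
    by (metis (no_types, lifting) mem_Collect_eq space_finite_law)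
  then have sum_w: "(\<Sum>i\<in>I. w i) = 1"
    using sum1[of "\<lambda>_ _. 1"] fin by (subst (asm) \<zeta>1) (simp add: emeasure_finite_law case_prod_unfold)
  let ?\<zeta> = "finite_law I w (\<lambda>i. (X i, Z i))"
  show thesis
  proof
    show "?\<zeta> \<in> couplings a c"
      unfolding a' c' by (rule finite_coupling[OF I sum_w])
    have "(\<integral>\<^sup>+ p. ennreal (dist (fst p) (snd p)) \<partial>?\<zeta>) = (\<Sum>(x, y, z)\<in>I. w (x, y, z) * ennreal (dist x z))"
      using I by (simp add: nn_integral_finite_law X_def Z_def case_prod_unfold)
    also have "\<dots> \<le> (\<Sum>(x, y, z)\<in>I. w (x, y, z) * ennreal (dist x y) + w (x, y, z) * ennreal (dist y z))"
      unfolding distrib_left[symmetric]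
      by (auto intro!: sum_mono mult_left_mono ennreal_leI dist_triangle simp flip: ennreal_plus)
    also have "\<dots> = (\<Sum>(x, y)\<in>S \<times> S. z1 (x, y) * ennreal (dist x y)) +
        (\<Sum>(y, z)\<in>S \<times> S. z2 (y, z) * ennreal (dist y z))"
      unfolding sum1[symmetric] sum2[symmetric] by (simp add: sum.distrib case_prod_unfold)
    also have "\<dots> = (\<integral>\<^sup>+ p. ennreal (dist (fst p) (snd p)) \<partial>\<zeta>\<^sub>1) +
        (\<integral>\<^sup>+ p. ennreal (dist (fst p) (snd p)) \<partial>\<zeta>\<^sub>2)"
      using fin by (subst \<zeta>1, subst \<zeta>2) (simp add: nn_integral_finite_law case_prod_unfold)
    finally show "(\<integral>\<^sup>+ p. ennreal (dist (fst p) (snd p)) \<partial>?\<zeta>) \<le> \<dots>" .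
  qed
qed

lemma wasserstein_dist_triangle:
  assumes S: "finite S" "emeasure a (- S) = 0" "emeasure b (- S) = 0" "emeasure c (- S) = 0"
  shows "wasserstein_dist a c \<le> wasserstein_dist a b + wasserstein_dist b c"
proof (rule ennreal_le_epsilon)
  fix e :: real
  assume top: "wasserstein_dist a b + wasserstein_dist b c < \<top>" and e: "0 < e"
  then have lt: "wasserstein_dist a b < wasserstein_dist a b + ennreal (e/2)"
      "wasserstein_dist b c < wasserstein_dist b c + ennreal (e/2)"
    by (auto simp: ennreal_add_left_cancel_less)
  obtain \<zeta>\<^sub>1 where \<zeta>1: "\<zeta>\<^sub>1 \<in> couplings a b"
    "(\<integral>\<^sup>+ p. ennreal (dist (fst p) (snd p)) \<partial>\<zeta>\<^sub>1) < wasserstein_dist a b + ennreal (e/2)"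
    using lt(1) by (subst (asm) (1) wasserstein_dist_def) (auto simp: INF_less_iff)
  obtain \<zeta>\<^sub>2 where \<zeta>2: "\<zeta>\<^sub>2 \<in> couplings b c"
    "(\<integral>\<^sup>+ p. ennreal (dist (fst p) (snd p)) \<partial>\<zeta>\<^sub>2) < wasserstein_dist b c + ennreal (e/2)"
    using lt(2) by (subst (asm) (1) wasserstein_dist_def) (auto simp: INF_less_iff)
  obtain \<zeta> where \<zeta>: "\<zeta> \<in> couplings a c"
    "(\<integral>\<^sup>+ p. ennreal (dist (fst p) (snd p)) \<partial>\<zeta>) \<le>
     (\<integral>\<^sup>+ p. ennreal (dist (fst p) (snd p)) \<partial>\<zeta>\<^sub>1) + (\<integral>\<^sup>+ p. ennreal (dist (fst p) (snd p)) \<partial>\<zeta>\<^sub>2)"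
    using couplings_glue[OF \<zeta>1(1) \<zeta>2(1) S] .
  have "wasserstein_dist a c \<le> (\<integral>\<^sup>+ p. ennreal (dist (fst p) (snd p)) \<partial>\<zeta>)"
    unfolding wasserstein_dist_def by (rule INF_lower[OF \<zeta>(1)])
  also note \<zeta>(2)
  also have "(\<integral>\<^sup>+ p. ennreal (dist (fst p) (snd p)) \<partial>\<zeta>\<^sub>1) + (\<integral>\<^sup>+ p. ennreal (dist (fst p) (snd p)) \<partial>\<zeta>\<^sub>2)
      \<le> (wasserstein_dist a b + ennreal (e/2)) + (wasserstein_dist b c + ennreal (e/2))"
    using \<zeta>1(2) \<zeta>2(2) by (intro add_mono less_imp_le)
  also have "\<dots> = wasserstein_dist a b + wasserstein_dist b c + ennreal e"
    using e by (simp add: add_ac ennreal_plus[symmetric] del: ennreal_plus)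
  finally show "wasserstein_dist a c \<le> wasserstein_dist a b + wasserstein_dist b c + ennreal e" .
qed

text \<open>
  The case of \<open>0\<close> iterates is included: the null measure also vanishes off every finite set.
\<close>

lemma wasserstein_dist_empirical_triangle:
  "wasserstein_dist (empirical_measure n f x) (empirical_measure k h z) \<le>
    wasserstein_dist (empirical_measure n f x) (empirical_measure m g y) +
    wasserstein_dist (empirical_measure m g y) (empirical_measure k h z)"
proof -
  define S where "S = (\<lambda>i. (f ^^ i) x) ` {..<n} \<union> (\<lambda>i. (g ^^ i) y) ` {..<m} \<union> (\<lambda>i. (h ^^ i) z) ` {..<k}"
  have null: "emeasure (empirical_measure l F u) (- S) = 0"
    if "(\<lambda>i. (F ^^ i) u) ` {..<l} \<subseteq> S" for l F u
  proof -
    have "- (\<lambda>i. (F ^^ i) u) ` {..<l} \<in> sets borel"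
      by (intro borel_open open_Compl finite_imp_closed) simp
    then have "emeasure (empirical_measure l F u) (- S)
        \<le> emeasure (empirical_measure l F u) (- (\<lambda>i. (F ^^ i) u) ` {..<l})"
      using that by (intro emeasure_mono) auto
    then show ?thesis by (simp add: empirical_measure_finite_support)
  qed
  show ?thesis
  proof (rule wasserstein_dist_triangle)
    show "finite S" by (simp add: S_def)
    show "emeasure (empirical_measure n f x) (- S) = 0"
      by (rule null) (simp add: S_def Un_assoc)
    show "emeasure (empirical_measure m g y) (- S) = 0"
      by (rule null) (unfold S_def, blast)
    show "emeasure (empirical_measure k h z) (- S) = 0"
      by (rule null) (simp add: S_def)
  qed
qed

section \<open>Continuity of empirical measures\<close>

text \<open>
  Matching the two orbits time by time is a coupling.
\<close>

lemma wasserstein_dist_empirical_le: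
  assumes n: "n > 0" and e: "\<And>i. i < n \<Longrightarrow> dist ((f ^^ i) x) ((g ^^ i) y) \<le> e"
  shows "wasserstein_dist (empirical_measure n f x) (empirical_measure n g y) \<le> ennreal e"
proof -
  have one: "of_nat n * (1 / of_nat n :: ennreal) = 1"
    using n by (simp add: ennreal_times_divide ennreal_divide_self of_nat_less_top less_top)
  then have "wasserstein_dist (empirical_measure n f x) (empirical_measure n g y)
      \<le> (\<Sum>i<n. 1 / of_nat n * ennreal (dist ((f ^^ i) x) ((g ^^ i) y)))"
    unfolding empirical_measure_eq_finite_law by (intro wasserstein_dist_finite_law_le) auto
  also have "\<dots> \<le> (\<Sum>i<n. 1 / of_nat n * ennreal e)"
    using e by (intro sum_mono mult_left_mono ennreal_leI) auto
  also have "\<dots> = ennreal e"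
    using one by (simp add: mult.assoc[symmetric])
  finally show ?thesis .
qed

lemma ennreal_less_add_epsilon:
  fixes c d :: ennreal
  assumes "c < d"
  obtains e :: real where "e > 0" "c + ennreal e < d"
  using assms ennreal_le_epsilon[of c d] by (meson leD le_less_linear)

lemma continuous_on_funpow:
  fixes f :: "'a::topological_space \<Rightarrow> 'a"
  assumes "continuous_on UNIV f"
  shows "continuous_on UNIV (f ^^ i)"
proof (induction i)
  case 0
  then show ?case by (simp add: id_def)
next
  case (Suc i)
  have "continuous_on UNIV (\<lambda>x. f ((f ^^ i) x))"
    by (rule continuous_on_compose2[OF assms Suc]) simp
  then show ?case by (simp add: comp_def)
qed

text \<open>
  The function is lower semicontinuous: if its value at \<open>x\<close> exceeds \<open>c\<close> by more than \<open>e\<close>, then at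
  points \<open>y\<close> whose first iterates stay within \<open>e / 2\<close> of those of \<open>x\<close> it still exceeds \<open>c\<close>, by the
  triangle inequality through the empirical measures at \<open>y\<close>. The same scheme, with maps instead of
  points, serves below for the \<open>L\<^sup>1\<close> distance.
\<close>

lemma borel_measurable_wasserstein_empirical:
  fixes f g :: "'a::metric_space \<Rightarrow> 'a"
  assumes f: "continuous_on UNIV f" and g: "continuous_on UNIV g" and n: "n > 0" and m: "m > 0"
  shows "(\<lambda>x. wasserstein_dist (empirical_measure n f x) (empirical_measure m g x)) \<in> borel_measurable borel"
proof (rule borel_measurableI_greater)
  fix c :: ennreal
  let ?W = "\<lambda>x. wasserstein_dist (empirical_measure n f x) (empirical_measure m g x)"
  have near: "\<forall>\<^sub>F y in at x. \<forall>i<k. dist ((F ^^ i) x) ((F ^^ i) y) < e"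
    if "continuous_on UNIV F" "e > 0" for F :: "'a \<Rightarrow> 'a" and x e and k :: nat
  proof -
    have "\<forall>\<^sub>F y in at x. \<forall>i\<in>{..<k}. dist ((F ^^ i) y) ((F ^^ i) x) < e"
    proof (rule eventually_ball_finite)
      show "\<forall>i\<in>{..<k}. \<forall>\<^sub>F y in at x. dist ((F ^^ i) y) ((F ^^ i) x) < e"
        using continuous_on_funpow[OF that(1)] that(2)
        by (intro ballI tendstoD) (auto simp: continuous_on_def)
    qed simp
    then show ?thesis by eventually_elim (auto simp: dist_commute)
  qed
  have "open {x. c < ?W x}"
  proof (subst open_subopen, safe)
    fix x assume "c < ?W x"
    then obtain e where e: "e > 0" "c + ennreal e < ?W x" by (rule ennreal_less_add_epsilon)
    have e2: "e / 2 > 0" using e by simp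
    have "\<forall>\<^sub>F y in at x. c < ?W y"
      using near[OF f e2, where x = x and k = n] near[OF g e2, where x = x and k = m]
    proof eventually_elim
      case (elim y)
      have 1: "wasserstein_dist (empirical_measure n f x) (empirical_measure n f y) \<le> ennreal (e/2)"
        using n elim by (intro wasserstein_dist_empirical_le) (auto intro: less_imp_le)
      have 2: "wasserstein_dist (empirical_measure m g y) (empirical_measure m g x) \<le> ennreal (e/2)"
        using m elim by (intro wasserstein_dist_empirical_le) (auto intro: less_imp_le simp: dist_commute)
      have "?W x \<le> wasserstein_dist (empirical_measure n f x) (empirical_measure n f y) +
          (?W y + wasserstein_dist (empirical_measure m g y) (empirical_measure m g x))"
        by (rule order_trans[OF wasserstein_dist_empirical_triangle
              add_left_mono[OF wasserstein_dist_empirical_triangle]])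
      also have "\<dots> \<le> ennreal (e/2) + (?W y + ennreal (e/2))"
        using 1 2 by (intro add_mono) auto
      also have "\<dots> = ?W y + (ennreal (e/2) + ennreal (e/2))" by (simp add: add_ac)
      also have "ennreal (e/2) + ennreal (e/2) = ennreal e"
        using e by (subst ennreal_plus[symmetric]) auto
      finally have "?W x \<le> ?W y + ennreal e" .
      with e(2) have "c + ennreal e < ?W y + ennreal e" by (rule less_le_trans)
      then show ?case by (metis add_right_mono leD leI)
    qed
    then obtain A where "open A" "x \<in> A" "\<And>y. y \<in> A \<Longrightarrow> y \<noteq> x \<Longrightarrow> c < ?W y"
      unfolding eventually_at_topological by blast
    with \<open>c < ?W x\<close> have "A \<subseteq> {x. c < ?W x}" by blast
    with \<open>open A\<close> \<open>x \<in> A\<close> show "\<exists>T. open T \<and> x \<in> T \<and> T \<subseteq> {x. c < ?W x}"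
      by blast
  qed
  then show "{x \<in> space borel. c < ?W x} \<in> sets borel" by simp
qed

text \<open>
  Positivity of the numbers of iterates enters through measurability of the integrands, which the
  additivity of the integral requires.
\<close>

lemma L1_dist_triangle:
  assumes \<mu>: "sets \<mu> = sets borel"
    and "continuous_on UNIV f" "continuous_on UNIV g" "continuous_on UNIV h"
    and "n > 0" "m > 0" "k > 0"
  shows "L1_dist \<mu> (empirical_measure n f) (empirical_measure k h) \<le>
    L1_dist \<mu> (empirical_measure n f) (empirical_measure m g) +
    L1_dist \<mu> (empirical_measure m g) (empirical_measure k h)"
proof -
  have meas: "(\<lambda>x. wasserstein_dist (empirical_measure n f x) (empirical_measure m g x)) \<in> borel_measurable \<mu>"
    "(\<lambda>x. wasserstein_dist (empirical_measure m g x) (empirical_measure k h x)) \<in> borel_measurable \<mu>"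
    using assms by (auto simp: measurable_cong_sets[OF \<mu> refl] intro!: borel_measurable_wasserstein_empirical)
  show ?thesis
    unfolding L1_dist_def nn_integral_add[OF meas, symmetric]
    by (intro nn_integral_mono wasserstein_dist_empirical_triangle)
qed

text \<open>
  Compactness enters here: uniform continuity of \<open>f\<close> propagates a uniform error through one more
  iterate.
\<close>

lemma iterates_uniformly_close:
  fixes f :: "'a::metric_space \<Rightarrow>\<^sub>C 'a"
  assumes compact: "compact (UNIV :: 'a set)" and "e > 0"
  obtains d where "d > 0"
    "\<And>g x. dist f g < d \<Longrightarrow> dist ((apply_bcontfun f ^^ i) x) ((apply_bcontfun g ^^ i) x) < e"
proof -
  have "\<exists>d>0. \<forall>g x. dist f g < d \<longrightarrow> dist ((apply_bcontfun f ^^ i) x) ((apply_bcontfun g ^^ i) x) < e"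
    using \<open>e > 0\<close>
  proof (induction i arbitrary: e)
    case 0
    then show ?case by (auto intro: exI[of _ 1])
  next
    case (Suc i)
    have "uniformly_continuous_on UNIV (apply_bcontfun f)"
      by (intro compact_uniformly_continuous compact) simp
    then obtain d1 where d1: "d1 > 0" "\<And>x y. dist x y < d1 \<Longrightarrow> dist (f x) (f y) < e/2"
      unfolding uniformly_continuous_on_def using Suc.prems by (metis UNIV_I half_gt_zero dist_commute)
    obtain d2 where d2: "d2 > 0"
      "\<And>g x. dist f g < d2 \<Longrightarrow> dist ((apply_bcontfun f ^^ i) x) ((apply_bcontfun g ^^ i) x) < d1"
      using Suc.IH[OF d1(1)] by blast
    have "dist ((apply_bcontfun f ^^ Suc i) x) ((apply_bcontfun g ^^ Suc i) x) < e"
      if "dist f g < min d2 (e/2)" for g x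
    proof -
      let ?x = "(apply_bcontfun f ^^ i) x" and ?y = "(apply_bcontfun g ^^ i) x"
      have "dist (f ?x) (g ?y) \<le> dist (f ?x) (f ?y) + dist (f ?y) (g ?y)"
        by (rule dist_triangle)
      also have "dist (f ?x) (f ?y) < e/2" using d1(2) d2(2) that by simp
      also have "dist (f ?y) (g ?y) < e/2" using that by (intro dist_fun_lt_imp_dist_val_lt) simp
      finally show ?thesis by simp
    qed
    then show ?case using d2(1) Suc.prems by (intro exI[of _ "min d2 (e/2)"]) auto
  qed
  then show thesis using that by blast
qed

text \<open>
  The empirical function at a fixed time is \<open>C\<^sup>0\<close>-continuous in the map, in the form of a bound
  between any two maps near \<open>f\<close>.
\<close>

lemma L1_dist_empirical_close:
  fixes f :: "'a::metric_space \<Rightarrow>\<^sub>C 'a"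
  assumes compact: "compact (UNIV :: 'a set)" and prob: "prob_space \<mu>"
    and e: "e > 0" and n: "n > 0"
  obtains d where "d > 0"
    "\<And>g h. dist f g < d \<Longrightarrow> dist f h < d \<Longrightarrow>
      L1_dist \<mu> (empirical_measure n g) (empirical_measure n h) \<le> ennreal e"
proof -
  have "\<forall>i. \<exists>d>0. \<forall>g x. dist f g < d \<longrightarrow> dist ((apply_bcontfun f ^^ i) x) ((apply_bcontfun g ^^ i) x) < e/2"
    using iterates_uniformly_close[OF compact, of "e/2" f] e by (metis half_gt_zero)
  then obtain D where D: "\<And>i. D i > 0"
    "\<And>i g x. dist f g < D i \<Longrightarrow> dist ((apply_bcontfun f ^^ i) x) ((apply_bcontfun g ^^ i) x) < e/2"
    by metis
  define d where "d = Min (D ` {..<n})"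
  have d: "d > 0" "\<And>i. i < n \<Longrightarrow> d \<le> D i"
  proof -
    have "D ` {..<n} \<noteq> {}" using n by auto
    then show "d > 0" using D(1) unfolding d_def by (subst Min_gr_iff) auto
  qed (auto simp: d_def)
  have "L1_dist \<mu> (empirical_measure n g) (empirical_measure n h) \<le> ennreal e"
    if g: "dist f g < d" and h: "dist f h < d" for g h
  proof -
    have "wasserstein_dist (empirical_measure n g x) (empirical_measure n h x) \<le> ennreal e" for x
    proof (rule wasserstein_dist_empirical_le[OF n])
      fix i assume "i < n"
      then have "dist f g < D i" "dist f h < D i" using g h d(2) by force+
      from D(2)[OF this(1), of x] D(2)[OF this(2), of x]
      show "dist ((apply_bcontfun g ^^ i) x) ((apply_bcontfun h ^^ i) x) \<le> e"
        by (intro order_trans[OF dist_triangle3[of _ _ "(apply_bcontfun f ^^ i) x"]]) simp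
    qed
    then have "L1_dist \<mu> (empirical_measure n g) (empirical_measure n h) \<le> (\<integral>\<^sup>+ x. ennreal e \<partial>\<mu>)"
      unfolding L1_dist_def by (intro nn_integral_mono)
    also have "\<dots> = ennreal e" using prob_space.emeasure_space_1[OF prob] by simp
    finally show ?thesis .
  qed
  then show thesis using that d(1) by blast
qed

section \<open>Divergence and oscillation\<close>

text \<open>
  Lower semicontinuity of the distance between two empirical functions of the same map. The open set
  produced is a \<open>C\<^sup>0\<close> ball in \<open>\<Lambda>\<close>, and is open for the finer topology.
\<close>

lemma openin_oscillating_maps:
  fixes \<mu> :: "'a::metric_space measure" and T :: "('a \<Rightarrow>\<^sub>C 'a) topology"
  assumes compact: "compact (UNIV :: 'a set)" and prob: "prob_space \<mu>" and borel: "sets \<mu> = sets borel"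
    and finer: "\<And>S. openin (top_of_set (topspace T)) S \<Longrightarrow> openin T S"
    and n: "n > 0" and m: "m > 0"
  shows "openin T {f \<in> topspace T. c < L1_dist \<mu> (empirical_measure n f) (empirical_measure m f)}"
proof (subst openin_subopen, safe)
  fix f :: "'a \<Rightarrow>\<^sub>C 'a"
  let ?L = "\<lambda>f :: 'a \<Rightarrow>\<^sub>C 'a. L1_dist \<mu> (empirical_measure n f) (empirical_measure m f)"
  assume f: "f \<in> topspace T" "c < ?L f"
  obtain e where e: "e > 0" "c + ennreal e < ?L f" using f(2) by (rule ennreal_less_add_epsilon)
  have e2: "e/2 > 0" using e by simp
  obtain d1 where d1: "d1 > 0"
    "\<And>g h. dist f g < d1 \<Longrightarrow> dist f h < d1 \<Longrightarrow>
      L1_dist \<mu> (empirical_measure n g) (empirical_measure n h) \<le> ennreal (e/2)"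
    using L1_dist_empirical_close[OF compact prob e2 n, of f] by blast
  obtain d2 where d2: "d2 > 0"
    "\<And>g h. dist f g < d2 \<Longrightarrow> dist f h < d2 \<Longrightarrow>
      L1_dist \<mu> (empirical_measure m g) (empirical_measure m h) \<le> ennreal (e/2)"
    using L1_dist_empirical_close[OF compact prob e2 m, of f] by blast
  let ?B = "topspace T \<inter> ball f (min d1 d2)"
  have "c < ?L g" if g: "g \<in> ?B" for g
  proof -
    have "?L f \<le> L1_dist \<mu> (empirical_measure n f) (empirical_measure n g) +
        L1_dist \<mu> (empirical_measure n g) (empirical_measure m f)"
      using n m by (intro L1_dist_triangle borel) auto
    also have "L1_dist \<mu> (empirical_measure n g) (empirical_measure m f) \<le>
        ?L g + L1_dist \<mu> (empirical_measure m g) (empirical_measure m f)"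
      using n m by (intro L1_dist_triangle borel) auto
    also have "L1_dist \<mu> (empirical_measure n f) (empirical_measure n g) +
        (?L g + L1_dist \<mu> (empirical_measure m g) (empirical_measure m f))
        \<le> ennreal (e/2) + (?L g + ennreal (e/2))"
      using g d1 d2 by (intro add_mono) auto
    also have "\<dots> = ?L g + (ennreal (e/2) + ennreal (e/2))" by (simp add: add_ac)
    also have "ennreal (e/2) + ennreal (e/2) = ennreal e"
      using e by (subst ennreal_plus[symmetric]) auto
    finally have "?L f \<le> ?L g + ennreal e" by (simp add: add_left_mono)
    with e(2) have "c + ennreal e < ?L g + ennreal e" by (rule less_le_trans)
    then show ?thesis by (meson add_right_mono leI leD)
  qed
  moreover have "openin T ?B" by (intro finer openin_open_Int) simp
  moreover have "f \<in> ?B" using f d1 d2 by simp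
  ultimately show "\<exists>S. openin T S \<and> f \<in> S \<and> S \<subseteq> {f \<in> topspace T. c < ?L f}"
    by (intro exI[of _ ?B]) auto
qed

text \<open>
  A neighbourhood that witnesses \<open>\<Delta>(f) < c\<close> is a neighbourhood of each of its points, so it
  witnesses the same bound there.
\<close>

lemma openin_small_divergence:
  "openin T {f \<in> topspace T. L1_divergence \<mu> T f < c}"
proof (subst openin_subopen, safe)
  fix f assume f: "f \<in> topspace T" "L1_divergence \<mu> T f < c"
  then obtain V N where V: "openin T V" "f \<in> V" and lt:
    "(SUP h\<in>V. SUP g\<in>V. SUP m\<in>{N::nat..}. SUP n\<in>{N..}.
        L1_dist \<mu> (empirical_measure n (apply_bcontfun h)) (empirical_measure m (apply_bcontfun g))) < c"
    unfolding L1_divergence_def by (auto simp: INF_less_iff)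
  have "L1_divergence \<mu> T g < c" if "g \<in> V" for g
    unfolding L1_divergence_def using V that lt by (auto simp: INF_less_iff)
  then show "\<exists>S. openin T S \<and> f \<in> S \<and> S \<subseteq> {f \<in> topspace T. L1_divergence \<mu> T f < c}"
    using V openin_subset by (intro exI[of _ V]) blast
qed

text \<open>
  The density claim: divergence between different nearby maps at different times must already show up
  along a single map, since at one fixed time the empirical
  functions of nearby maps almost agree.
\<close>

lemma ex_oscillating_map:
  fixes \<mu> :: "'a::metric_space measure" and T :: "('a \<Rightarrow>\<^sub>C 'a) topology"
  assumes compact: "compact (UNIV :: 'a set)" and prob: "prob_space \<mu>" and borel: "sets \<mu> = sets borel"
    and finer: "\<And>S. openin (top_of_set (topspace T)) S \<Longrightarrow> openin T S"
    and V: "openin T V" "f \<in> V" and c: "c > 0" and div: "ennreal (3 * c) < L1_divergence \<mu> T f"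
  obtains g n m where "g \<in> V" "n > N" "m > N"
    "ennreal c < L1_dist \<mu> (empirical_measure n (apply_bcontfun g)) (empirical_measure m (apply_bcontfun g))"
proof (rule ccontr)
  assume "\<not> thesis"
  with that have small: "L1_dist \<mu> (empirical_measure n (apply_bcontfun g)) (empirical_measure m (apply_bcontfun g)) \<le> ennreal c"
    if "g \<in> V" "n > N" "m > N" for g n m
    using \<open>g \<in> V\<close> \<open>n > N\<close> \<open>m > N\<close> leI by blast
  obtain d where d: "d > 0"
    "\<And>g h. dist f g < d \<Longrightarrow> dist f h < d \<Longrightarrow>
      L1_dist \<mu> (empirical_measure (Suc N) g) (empirical_measure (Suc N) h) \<le> ennreal c"
    using L1_dist_empirical_close[OF compact prob c, of "Suc N" f] by blast
  define V' where "V' = V \<inter> (topspace T \<inter> ball f d)"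
  have V': "openin T V'" "f \<in> V'"
    using V d(1) openin_subset[OF V(1)] unfolding V'_def
    by (auto intro: openin_Int[OF V(1) finer[OF openin_open_Int[OF open_ball]]])
  \<comment> \<open>Compare through time \<open>Suc N\<close>: first along \<open>h\<close>, then from \<open>h\<close> to \<open>g\<close>, then along \<open>g\<close>.\<close>
  have bound: "L1_dist \<mu> (empirical_measure n (apply_bcontfun h)) (empirical_measure m (apply_bcontfun g)) \<le> ennreal (3 * c)"
    if "h \<in> V'" "g \<in> V'" "m \<ge> Suc N" "n \<ge> Suc N" for h g m n
  proof -
    let ?L = "\<lambda>n (h :: 'a \<Rightarrow>\<^sub>C 'a) m (g :: 'a \<Rightarrow>\<^sub>C 'a). L1_dist \<mu> (empirical_measure n h) (empirical_measure m g)"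
    have "?L n h m g \<le> ?L n h (Suc N) h + ?L (Suc N) h m g"
      using that by (intro L1_dist_triangle borel) auto
    also have "?L (Suc N) h m g \<le> ?L (Suc N) h (Suc N) g + ?L (Suc N) g m g"
      using that by (intro L1_dist_triangle borel) auto
    also have "?L n h (Suc N) h + (?L (Suc N) h (Suc N) g + ?L (Suc N) g m g)
        \<le> ennreal c + (ennreal c + ennreal c)"
      using that d(2) small by (intro add_mono) (auto simp: V'_def)
    also have "\<dots> = ennreal (3 * c)"
      using c by (simp flip: ennreal_plus)
    finally show ?thesis by (meson add_left_mono order_trans)
  qed
  have "L1_divergence \<mu> T f \<le> (SUP h\<in>V'. SUP g\<in>V'. SUP m\<in>{Suc N..}. SUP n\<in>{Suc N..}.
        L1_dist \<mu> (empirical_measure n (apply_bcontfun h)) (empirical_measure m (apply_bcontfun g)))"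
    unfolding L1_divergence_def using V' by (intro INF_lower2[of V'] INF_lower) auto
  also have "\<dots> \<le> ennreal (3 * c)"
    using bound by (intro SUP_least) auto
  finally show False using div by simp
qed

lemma L1_non_statisticalI:
  assumes c: "c > 0" and osc: "\<And>N. \<exists>n>N. \<exists>m>N. c < L1_dist \<mu> (empirical_measure n f) (empirical_measure m f)"
  shows "L1_non_statistical \<mu> f"
proof -
  have "c \<le> Limsup (sequentially \<times>\<^sub>F sequentially)
      (\<lambda>(m, n). L1_dist \<mu> (empirical_measure n f) (empirical_measure m f))"
    unfolding Limsup_def
  proof (rule INF_greatest)
    fix P :: "nat \<times> nat \<Rightarrow> bool"
    assume "P \<in> {P. eventually P (sequentially \<times>\<^sub>F sequentially)}"
    then obtain N where N: "\<And>m n. m \<ge> N \<Longrightarrow> n \<ge> N \<Longrightarrow> P (m, n)"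
      by (auto simp: eventually_prod_sequentially)
    obtain n m where nm: "n > N" "m > N" "c < L1_dist \<mu> (empirical_measure n f) (empirical_measure m f)"
      using osc by blast
    then have "(m, n) \<in> Collect P" using N by simp
    then show "c \<le> (SUP p\<in>Collect P. case p of (m, n) \<Rightarrow> L1_dist \<mu> (empirical_measure n f) (empirical_measure m f))"
      using nm(3) by (intro SUP_upper2[of "(m, n)"]) auto
  qed
  then show ?thesis using c unfolding L1_non_statistical_def by (rule less_le_trans[rotated])
qed

section \<open>Genericity\<close>

theorem theoremD:
  fixes \<mu> :: "'a::metric_space measure"
    and \<Lambda> :: "('a \<Rightarrow>\<^sub>C 'a) set"
    and T :: "('a \<Rightarrow>\<^sub>C 'a) topology"
    and \<U> :: "('a \<Rightarrow>\<^sub>C 'a) set"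
  assumes compact: "compact (UNIV :: 'a set)"
    and prob: "prob_space \<mu>"
    and borel: "sets \<mu> = sets borel"
    and space: "topspace T = \<Lambda>"
    and finer: "\<And>S. openin (top_of_set \<Lambda>) S \<Longrightarrow> openin T S"
    and U_eq: "\<U> = T interior_of {f \<in> \<Lambda>. L1_statistically_unstable \<mu> T f}"
  shows "baire_generic_in (subtopology T \<U>) {f \<in> \<U>. L1_non_statistical \<mu> (apply_bcontfun f)}"
proof -
  \<comment> \<open>The factor \<open>4\<close> in \<open>small\<close> leaves the strict inequality \<open>3 * c k < \<Delta>(f)\<close> off \<open>small k\<close> that
    the density claim asks for.\<close>
  define c where "c k = 1 / real (Suc k)" for k
  have c: "c k > 0" for k by (simp add: c_def)
  define osc where "osc k n m = {f \<in> topspace T.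
      ennreal (c k) < L1_dist \<mu> (empirical_measure n (apply_bcontfun f)) (empirical_measure m (apply_bcontfun f))}"
    for k n m
  define small where "small k = {f \<in> topspace T. L1_divergence \<mu> T f < ennreal (4 * c k)}" for k
  define G where "G k N = \<U> \<inter> (small k \<union> (\<Union>n\<in>{N<..}. \<Union>m\<in>{N<..}. osc k n m))" for k N
  have U_open: "openin T \<U>" unfolding U_eq by simp
  have U_unstable: "f \<in> topspace T" "L1_divergence \<mu> T f > 0" if "f \<in> \<U>" for f
    using interior_of_subset[of T] that unfolding U_eq L1_statistically_unstable_def by blast+
  have topU: "topspace (subtopology T \<U>) = \<U>"
    using openin_subset[OF U_open] by auto
  have finer': "openin T S" if "openin (top_of_set (topspace T)) S" for S
    using finer space that by simp
  have G_open: "openin (subtopology T \<U>) (G k N)" for k N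
  proof -
    have "openin T (osc k n m)" if "n \<in> {N<..}" "m \<in> {N<..}" for n m
      unfolding osc_def using that by (intro openin_oscillating_maps[OF compact prob borel finer']) auto
    then have "openin T (G k N)"
      unfolding G_def small_def
      by (intro openin_Int U_open openin_Un openin_small_divergence openin_Union) auto
    then show ?thesis unfolding openin_open_subtopology[OF U_open] by (auto simp: G_def)
  qed
  have G_dense: "subtopology T \<U> closure_of G k N = topspace (subtopology T \<U>)" for k N
    unfolding dense_intersects_open
  proof (intro allI impI, elim conjE)
    fix V assume V: "openin (subtopology T \<U>) V" "V \<noteq> {}"
    then obtain f where f: "f \<in> V" by auto
    have V': "openin T V" "V \<subseteq> \<U>" using V openin_open_subtopology[OF U_open] by auto
    show "G k N \<inter> V \<noteq> {}"
    proof (cases "f \<in> small k")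
      case True
      then show ?thesis using f V' by (auto simp: G_def)
    next
      case False
      have "ennreal (3 * c k) < ennreal (4 * c k)" using c[of k] by (intro ennreal_lessI) auto
      also have "\<dots> \<le> L1_divergence \<mu> T f"
        using False U_unstable f V' by (auto simp: small_def not_less)
      finally obtain g n m where "g \<in> V" "n > N" "m > N"
        "ennreal (c k) < L1_dist \<mu> (empirical_measure n (apply_bcontfun g)) (empirical_measure m (apply_bcontfun g))"
        using ex_oscillating_map[OF compact prob borel finer' V'(1) f c] by blast
      then have "g \<in> G k N \<inter> V"
        using V' U_unstable unfolding G_def osc_def by auto
      then show ?thesis by blast
    qed
  qed
  have "L1_non_statistical \<mu> (apply_bcontfun f)" if f: "f \<in> \<U>" "\<And>k N. f \<in> G k N" for f
  proof -
    obtain r where r: "r > 0" "0 + ennreal r < L1_divergence \<mu> T f"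
      using U_unstable(2)[OF f(1)] by (rule ennreal_less_add_epsilon)
    obtain k where k: "1 / real (Suc k) < r / 4"
      using nat_approx_posE[of "r/4"] r(1) by auto
    have "ennreal (4 * c k) \<le> ennreal r" using k by (intro ennreal_leI) (simp add: c_def)
    with r(2) have "\<not> L1_divergence \<mu> T f < ennreal (4 * c k)" by simp
    then have "f \<notin> small k" by (simp add: small_def)
    then have "\<exists>n>N. \<exists>m>N. ennreal (c k) <
        L1_dist \<mu> (empirical_measure n (apply_bcontfun f)) (empirical_measure m (apply_bcontfun f))" for N
      using f(2)[of k N] by (auto simp: G_def osc_def)
    then show ?thesis using c[of k] by (intro L1_non_statisticalI[of "ennreal (c k)"]) auto
  qed
  then show ?thesis
    unfolding baire_generic_in_def topU using G_open G_dense topU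
    by (intro conjI exI[of _ "range (\<lambda>(k, N). G k N)"]) auto
qed

end
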